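(* Let $\exists^{t}_{[\underline{q},\overline{q}]} v\;\phi$ be a constraint (in the first-order language with approximate quantifiers over the m-structure $\mathcal{S}$) such that the tag $t$ does not occur in $\phi$. Let $\check{d}_{\phi}$ be a biapproximate solution set of $\phi$, and let $P$ be the biapproximate $(v,[\underline{q},\overline{q}])$-projection operator. Then $\mathrm{Ext}(P)(\check{d}_{\phi})$ is a biapproximate solution set of $\exists^{t}_{[\underline{q},\overline{q}]} v\;\phi$.
   Context: Setting. An m-structure $\mathcal{S}$ consists of a measure space on a set $D$ with measure $\mu$, together with a relation/function on $D$ for each relation/function symbol. $V$ is a finite set of variables; a variable assignment is a function $\theta:V\to D$, and $\theta[a/v]$ agrees with $\theta$ except that it maps $v$ to $a$. A potential solution set is a set of variable assignments. For $A\subseteq D$, the inner measure $\underline{\mu}(A)$ is the supremum of measures of measurable subsets of $A$ and the outer measure $\overline{\mu}(A)$ the infimum of measures of measurable supersets. A possible measure is a function $\mu'$ on all subsets of $D$ with $\mu'(A)\in[\underline{\mu}(A),\overline{\mu}(A)]$ for all $A$. Language. Formulas are first-order formulas except that quantifiers are approximate quantifiers $\exists^{t}_{[\underline{q},\overline{q}]}$, $\forall^{t}_{[\underline{q},\overline{q}]}$ with an annotation (a nonnegative real interval $[\underline{q},\overline{q}]$) and a tag $t\in\mathbb{N}$; within a formula, quantifiers with equal tags have equal annotations. A quantifier choice for $\phi$ is a function $q^{*}:\mathbb{N}\to\mathbb{R}$ with $q^{*}(t)$ in the annotation of the quantifiers tagged $t$, for each tag $t$ occurring in $\phi$. A measure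 guess is a function $\mu^{*}$ assigning to each $t\in\mathbb{N}$ a possible measure. For a formula $\phi$, quantifier choice $q^{*}$ and measure guess $\mu^{*}$, the solution set $\mathrm{Sol}(\phi,q^{*},\mu^{*})$ (a potential solution set) is defined compositionally, with atomic formulas and connectives interpreted as usual and $\mathrm{Sol}(\exists^{t}_{[\underline{q},\overline{q}]} v\,\psi,q^{*},\mu^{*})=\{\theta : \mu^{*}(t)(\{a\in D: \theta[a/v]\in \mathrm{Sol}(\psi,q^{*},\mu^{*})\})>q^{*}(t)\}$ (universal approximate quantifiers are interpreted by the corresponding volume-quantifier semantics). Approximation. An approximate solution set of $\phi$ under a quantifier choice $q^{*}$ is a set of potential solution sets containing $\mathrm{Sol}(\phi,q^{*},\mu^{*})$ for every measure guess $\mu^{*}$. A biapproximate solution set of $\phi$ is a set each of whose elements is an approximate solution set of $\phi$ under some quantifier choice for $\phi$. Projection. For $v\in V$, $q\ge 0$ and a possible measure $\mu'$, $P^{v}_{q,\mu'}$ maps a potential solution set $d$ to $\{\theta: \mu'(\{a\in D:\theta[a/v]\in d\})>q\}$. The approximate $(v,q)$-projection operator $P^{v}_{q}$ is the set of all $P^{v}_{q,\mu'}$, $\mu'$ a possible measure. The biapproximate $(v,[\underline{q},\overline{q}])$-projection operator is $\{P^{v}_{q}: q\in[\underline{q},\overline{q}]\}$. Extension. For a set $\hat{f}$ of functions and a set $\hat{d}$ of arguments, $\mathrm{Ext}(\hat{f})(\hat{d})=\{f(d): f\in\hat{f}, d\in\hat{d}\}$; for a set $\check{f}$ of such sets and a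 set $\check{d}$ of such argument sets, $\mathrm{Ext}(\check{f})(\check{d})=\{\mathrm{Ext}(\hat{f})(\hat{d}):\hat{f}\in\check{f},\hat{d}\in\check{d}\}$. *)

theory Defs
  imports "HOL-Analysis.Complete_Measure"
begin

record ('f, 'r) signature =
  fun_arity :: "'f \<Rightarrow> nat"
  rel_arity :: "'r \<Rightarrow> nat"

datatype ('f, 'v) trm = Var 'v | Fun 'f "('f, 'v) trm list"

text \<open>
  \<open>AEx t ql qh v \<phi>\<close> and \<open>AAll t ql qh v \<phi>\<close> are the approximate quantifiers with tag \<open>t\<close>,
  annotation \<open>[ql, qh]\<close> and bound variable \<open>v\<close>.
\<close>

datatype ('f, 'r, 'v) fm =
    Rel 'r "('f, 'v) trm list"
  | Neg "('f, 'r, 'v) fm"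
  | Conj "('f, 'r, 'v) fm" "('f, 'r, 'v) fm"
  | Disj "('f, 'r, 'v) fm" "('f, 'r, 'v) fm"
  | Impl "('f, 'r, 'v) fm" "('f, 'r, 'v) fm"
  | Iff "('f, 'r, 'v) fm" "('f, 'r, 'v) fm"
  | AEx nat real real 'v "('f, 'r, 'v) fm"
  | AAll nat real real 'v "('f, 'r, 'v) fm"

fun wf_trm :: "('f, 'r) signature \<Rightarrow> 'v set \<Rightarrow> ('f, 'v) trm \<Rightarrow> bool" where
  "wf_trm \<Sigma> V (Var x) \<longleftrightarrow> x \<in> V"
| "wf_trm \<Sigma> V (Fun f ts) \<longleftrightarrow> length ts = fun_arity \<Sigma> f \<and> (\<forall>s \<in> set ts. wf_trm \<Sigma> V s)"

fun wf_fm :: "('f, 'r) signature \<Rightarrow> 'v set \<Rightarrow> ('f, 'r, 'v) fm \<Rightarrow> bool" where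
  "wf_fm \<Sigma> V (Rel r ts) \<longleftrightarrow> length ts = rel_arity \<Sigma> r \<and> (\<forall>s \<in> set ts. wf_trm \<Sigma> V s)"
| "wf_fm \<Sigma> V (Neg \<phi>) \<longleftrightarrow> wf_fm \<Sigma> V \<phi>"
| "wf_fm \<Sigma> V (Conj \<phi> \<psi>) \<longleftrightarrow> wf_fm \<Sigma> V \<phi> \<and> wf_fm \<Sigma> V \<psi>"
| "wf_fm \<Sigma> V (Disj \<phi> \<psi>) \<longleftrightarrow> wf_fm \<Sigma> V \<phi> \<and> wf_fm \<Sigma> V \<psi>"
| "wf_fm \<Sigma> V (Impl \<phi> \<psi>) \<longleftrightarrow> wf_fm \<Sigma> V \<phi> \<and> wf_fm \<Sigma> V \<psi>"
| "wf_fm \<Sigma> V (Iff \<phi> \<psi>) \<longleftrightarrow> wf_fm \<Sigma> V \<phi> \<and> wf_fm \<Sigma> V \<psi>"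
| "wf_fm \<Sigma> V (AEx t ql qh v \<phi>) \<longleftrightarrow> 0 \<le> ql \<and> ql \<le> qh \<and> v \<in> V \<and> wf_fm \<Sigma> V \<phi>"
| "wf_fm \<Sigma> V (AAll t ql qh v \<phi>) \<longleftrightarrow> 0 \<le> ql \<and> ql \<le> qh \<and> v \<in> V \<and> wf_fm \<Sigma> V \<phi>"

text \<open>The set of pairs (tag, annotation) of the quantifiers occurring in a formula.\<close>

fun annots :: "('f, 'r, 'v) fm \<Rightarrow> (nat \<times> real \<times> real) set" where
  "annots (Rel r ts) = {}"
| "annots (Neg \<phi>) = annots \<phi>"
| "annots (Conj \<phi> \<psi>) = annots \<phi> \<union> annots \<psi>"
| "annots (Disj \<phi> \<psi>) = annots \<phi> \<union> annots \<psi>"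
| "annots (Impl \<phi> \<psi>) = annots \<phi> \<union> annots \<psi>"
| "annots (Iff \<phi> \<psi>) = annots \<phi> \<union> annots \<psi>"
| "annots (AEx t ql qh v \<phi>) = insert (t, ql, qh) (annots \<phi>)"
| "annots (AAll t ql qh v \<phi>) = insert (t, ql, qh) (annots \<phi>)"

definition tags :: "('f, 'r, 'v) fm \<Rightarrow> nat set" where
  "tags \<phi> = fst ` annots \<phi>"

definition constraint :: "('f, 'r) signature \<Rightarrow> 'v set \<Rightarrow> ('f, 'r, 'v) fm \<Rightarrow> bool" where
  "constraint \<Sigma> V \<phi> \<longleftrightarrow>
     wf_fm \<Sigma> V \<phi> \<and>
     (\<forall>t I J. (t, I) \<in> annots \<phi> \<longrightarrow> (t, J) \<in> annots \<phi> \<longrightarrow> I = J)"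

record ('d, 'f, 'r) mstruct =
  msp :: "'d measure"
  fun_int :: "'f \<Rightarrow> 'd list \<Rightarrow> 'd"
  rel_int :: "'r \<Rightarrow> 'd list \<Rightarrow> bool"

abbreviation dom_of :: "('d, 'f, 'r) mstruct \<Rightarrow> 'd set" where
  "dom_of S \<equiv> space (msp S)"

text \<open>
  Relation interpretations need no condition: only their values on lists over the domain of
  the right length matter.
\<close>

definition m_structure :: "('f, 'r) signature \<Rightarrow> ('d, 'f, 'r) mstruct \<Rightarrow> bool" where
  "m_structure \<Sigma> S \<longleftrightarrow>
     (\<forall>f as. length as = fun_arity \<Sigma> f \<longrightarrow> set as \<subseteq> dom_of S \<longrightarrow> fun_int S f as \<in> dom_of S)"

definition assignments :: "'v set \<Rightarrow> ('d, 'f, 'r) mstruct \<Rightarrow> ('v \<Rightarrow> 'd) set" where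
  "assignments V S = (V \<rightarrow>\<^sub>E dom_of S)"

definition potential_solution_sets :: "'v set \<Rightarrow> ('d, 'f, 'r) mstruct \<Rightarrow> ('v \<Rightarrow> 'd) set set" where
  "potential_solution_sets V S = Pow (assignments V S)"

definition inner_measure_of :: "'d measure \<Rightarrow> 'd set \<Rightarrow> ennreal" where
  "inner_measure_of M A = (SUP B \<in> {B \<in> sets M. B \<subseteq> A}. emeasure M B)"

text \<open>The outer measure is the library's \<^const>\<open>outer_measure_of\<close>.\<close>

definition possible_measure :: "'d measure \<Rightarrow> ('d set \<Rightarrow> ennreal) \<Rightarrow> bool" where
  "possible_measure M m \<longleftrightarrow>
     (\<forall>A \<subseteq> space M. inner_measure_of M A \<le> m A \<and> m A \<le> outer_measure_of M A)"

definition quantifier_choice :: "('f, 'r, 'v) fm \<Rightarrow> (nat \<Rightarrow> real) \<Rightarrow> bool" where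
  "quantifier_choice \<phi> q \<longleftrightarrow> (\<forall>(t, ql, qh) \<in> annots \<phi>. q t \<in> {ql..qh})"

definition measure_guess :: "('d, 'f, 'r) mstruct \<Rightarrow> (nat \<Rightarrow> 'd set \<Rightarrow> ennreal) \<Rightarrow> bool" where
  "measure_guess S m \<longleftrightarrow> (\<forall>t. possible_measure (msp S) (m t))"

fun tval :: "('d, 'f, 'r) mstruct \<Rightarrow> ('v \<Rightarrow> 'd) \<Rightarrow> ('f, 'v) trm \<Rightarrow> 'd" where
  "tval S \<theta> (Var x) = \<theta> x"
| "tval S \<theta> (Fun f ts) = fun_int S f (map (tval S \<theta>) ts)"

text \<open>
  The universal approximate quantifier is dual to the existential one: the set of values
  violating the body has volume at most \<open>q t\<close>.
\<close>

fun Sol :: "'v set \<Rightarrow> ('d, 'f, 'r) mstruct \<Rightarrow> ('f, 'r, 'v) fm \<Rightarrow> (nat \<Rightarrow> real)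
    \<Rightarrow> (nat \<Rightarrow> 'd set \<Rightarrow> ennreal) \<Rightarrow> ('v \<Rightarrow> 'd) set" where
  "Sol V S (Rel r ts) q m = {\<theta> \<in> assignments V S. rel_int S r (map (tval S \<theta>) ts)}"
| "Sol V S (Neg \<phi>) q m = assignments V S - Sol V S \<phi> q m"
| "Sol V S (Conj \<phi> \<psi>) q m = Sol V S \<phi> q m \<inter> Sol V S \<psi> q m"
| "Sol V S (Disj \<phi> \<psi>) q m = Sol V S \<phi> q m \<union> Sol V S \<psi> q m"
| "Sol V S (Impl \<phi> \<psi>) q m =
     {\<theta> \<in> assignments V S. \<theta> \<in> Sol V S \<phi> q m \<longrightarrow> \<theta> \<in> Sol V S \<psi> q m}"
| "Sol V S (Iff \<phi> \<psi>) q m =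
     {\<theta> \<in> assignments V S. \<theta> \<in> Sol V S \<phi> q m \<longleftrightarrow> \<theta> \<in> Sol V S \<psi> q m}"
| "Sol V S (AEx t ql qh v \<phi>) q m =
     {\<theta> \<in> assignments V S. m t {a \<in> dom_of S. \<theta>(v := a) \<in> Sol V S \<phi> q m} > ennreal (q t)}"
| "Sol V S (AAll t ql qh v \<phi>) q m =
     {\<theta> \<in> assignments V S. m t {a \<in> dom_of S. \<theta>(v := a) \<notin> Sol V S \<phi> q m} \<le> ennreal (q t)}"

definition approx_solution_set :: "'v set \<Rightarrow> ('d, 'f, 'r) mstruct \<Rightarrow> ('f, 'r, 'v) fm
    \<Rightarrow> (nat \<Rightarrow> real) \<Rightarrow> ('v \<Rightarrow> 'd) set set \<Rightarrow> bool" where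
  "approx_solution_set V S \<phi> q D \<longleftrightarrow>
     D \<subseteq> potential_solution_sets V S \<and> (\<forall>m. measure_guess S m \<longrightarrow> Sol V S \<phi> q m \<in> D)"

definition biapprox_solution_set :: "'v set \<Rightarrow> ('d, 'f, 'r) mstruct \<Rightarrow> ('f, 'r, 'v) fm
    \<Rightarrow> ('v \<Rightarrow> 'd) set set set \<Rightarrow> bool" where
  "biapprox_solution_set V S \<phi> DD \<longleftrightarrow>
     (\<forall>D \<in> DD. \<exists>q. quantifier_choice \<phi> q \<and> approx_solution_set V S \<phi> q D)"

definition projection :: "'v set \<Rightarrow> ('d, 'f, 'r) mstruct \<Rightarrow> 'v \<Rightarrow> real \<Rightarrow> ('d set \<Rightarrow> ennreal)
    \<Rightarrow> ('v \<Rightarrow> 'd) set \<Rightarrow> ('v \<Rightarrow> 'd) set" where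
  "projection V S v q m d =
     {\<theta> \<in> assignments V S. m {a \<in> dom_of S. \<theta>(v := a) \<in> d} > ennreal q}"

definition approx_projection :: "'v set \<Rightarrow> ('d, 'f, 'r) mstruct \<Rightarrow> 'v \<Rightarrow> real
    \<Rightarrow> (('v \<Rightarrow> 'd) set \<Rightarrow> ('v \<Rightarrow> 'd) set) set" where
  "approx_projection V S v q = {projection V S v q m | m. possible_measure (msp S) m}"

definition biapprox_projection :: "'v set \<Rightarrow> ('d, 'f, 'r) mstruct \<Rightarrow> 'v \<Rightarrow> real \<Rightarrow> real
    \<Rightarrow> (('v \<Rightarrow> 'd) set \<Rightarrow> ('v \<Rightarrow> 'd) set) set set" where
  "biapprox_projection V S v ql qh = {approx_projection V S v q | q. q \<in> {ql..qh}}"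

definition Ext1 :: "('a \<Rightarrow> 'b) set \<Rightarrow> 'a set \<Rightarrow> 'b set" where
  "Ext1 F D = {f d | f d. f \<in> F \<and> d \<in> D}"

definition Ext :: "('a \<Rightarrow> 'b) set set \<Rightarrow> 'a set set \<Rightarrow> 'b set set" where
  "Ext FF DD = {Ext1 F D | F D. F \<in> FF \<and> D \<in> DD}"

end

theory Submission
  imports Defs
begin

text \<open>
  Since the tag \<open>t\<close> does not occur in \<open>\<phi>\<close>, a quantifier choice for \<open>\<phi>\<close> may be redefined at \<open>t\<close> to
  any threshold \<open>r\<close> in the annotation without affecting the solution sets of \<open>\<phi>\<close>. For the
  choice so obtained, the solution set of the quantified formula under a measure guess \<open>m\<close> is the
  projection, with threshold \<open>r\<close> and possible measure \<open>m t\<close>, of the solution set of \<open>\<phi>\<close> under \<open>m\<close>.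
\<close>

text \<open>\<open>Sol\<close> reads the quantifier choice only at quantifiers, and there only at
  their tags.\<close>

lemma Sol_cong_tags:
  assumes "\<And>t. t \<in> tags \<phi> \<Longrightarrow> q t = q' t"
  shows "Sol V S \<phi> q m = Sol V S \<phi> q' m"
  using assms by (induction \<phi>) (auto simp: tags_def image_Un)

lemma Sol_upd_notin_tags:
  "t \<notin> tags \<phi> \<Longrightarrow> Sol V S \<phi> (q(t := r)) m = Sol V S \<phi> q m"
  by (rule Sol_cong_tags) auto

lemma quantifier_choice_AEx_upd:
  assumes "t \<notin> tags \<phi>" "quantifier_choice \<phi> q" "r \<in> {ql..qh}"
  shows "quantifier_choice (AEx t ql qh v \<phi>) (q(t := r))"
  using assms by (force simp: quantifier_choice_def tags_def)

lemma Sol_AEx_upd: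
  assumes "t \<notin> tags \<phi>"
  shows "Sol V S (AEx t ql qh v \<phi>) (q(t := r)) m = projection V S v r (m t) (Sol V S \<phi> q m)"
  by (simp add: projection_def Sol_upd_notin_tags[OF assms])

text \<open>The approximate projection ranges over all possible measures, so it covers whichever one
  a measure guess assigns to \<open>t\<close>.\<close>

lemma approx_solution_set_AEx:
  assumes t: "t \<notin> tags \<phi>" and D: "approx_solution_set V S \<phi> q D"
  shows "approx_solution_set V S (AEx t ql qh v \<phi>) (q(t := r)) (Ext1 (approx_projection V S v r) D)"
  unfolding approx_solution_set_def
proof (intro conjI allI impI)
  show "Ext1 (approx_projection V S v r) D \<subseteq> potential_solution_sets V S"
    by (auto simp: Ext1_def approx_projection_def potential_solution_sets_def projection_def)
next
  fix m assume m: "measure_guess S m"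
  then have "Sol V S \<phi> q m \<in> D"
    using D by (simp add: approx_solution_set_def)
  moreover have "projection V S v r (m t) \<in> approx_projection V S v r"
    using m by (auto simp: approx_projection_def measure_guess_def)
  ultimately show "Sol V S (AEx t ql qh v \<phi>) (q(t := r)) m \<in> Ext1 (approx_projection V S v r) D"
    unfolding Sol_AEx_upd[OF t] Ext1_def by blast
qed

theorem theorem1:
  fixes \<Sigma> :: "('f, 'r) signature"
    and S :: "('d, 'f, 'r) mstruct"
    and V :: "'v set"
    and \<phi> :: "('f, 'r, 'v) fm"
    and t :: nat and ql qh :: real and v :: 'v
    and d\<phi> :: "('v \<Rightarrow> 'd) set set set"
  assumes "m_structure \<Sigma> S"
    and "finite V"
    and "constraint \<Sigma> V (AEx t ql qh v \<phi>)"
    and "t \<notin> tags \<phi>"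
    and "biapprox_solution_set V S \<phi> d\<phi>"
  shows "biapprox_solution_set V S (AEx t ql qh v \<phi>) (Ext (biapprox_projection V S v ql qh) d\<phi>)"
  unfolding biapprox_solution_set_def
proof
  fix E assume "E \<in> Ext (biapprox_projection V S v ql qh) d\<phi>"
  \<comment> \<open>All projections that form \<open>E\<close> share one threshold \<open>r\<close>,
    so a single quantifier choice serves every measure guess.\<close>
  then obtain r D where r: "r \<in> {ql..qh}" and D: "D \<in> d\<phi>"
    and E: "E = Ext1 (approx_projection V S v r) D"
    unfolding Ext_def biapprox_projection_def by blast
  from assms(5) D obtain q where q: "quantifier_choice \<phi> q" "approx_solution_set V S \<phi> q D"
    unfolding biapprox_solution_set_def by blast
  show "\<exists>q. quantifier_choice (AEx t ql qh v \<phi>) q \<and> approx_solution_set V S (AEx t ql qh v \<phi>) q E"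
    unfolding E
    using quantifier_choice_AEx_upd[OF assms(4) q(1) r] approx_solution_set_AEx[OF assms(4) q(2)]
    by (intro exI[of _ "q(t := r)"] conjI)
qed

end
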